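(* Let $\mathbf{g}_i(\mathbf{x}_k)\in\mathbb{R}^d$ be a nonzero vector (the local stochastic gradient of client $i$ at round $k$), and let $\mathbf{u}^{(1)}_{k,i},\dots,\mathbf{u}^{(m)}_{k,i}\in\{-1,+1\}^d$ be independent random vectors with i.i.d. Rademacher entries. For the reconstructed gradient estimator $$\hat{\mathbf{g}}_i(\mathbf{x}_k)=\frac1m\sum_{j=1}^m\mathbf{u}^{(j)}_{k,i}(\mathbf{u}^{(j)}_{k,i})^\top\mathbf{g}_i(\mathbf{x}_k),$$ the expected relative squared error is $$\frac{\mathbb{E}_{\mathbf{U}}\big[\|\hat{\mathbf{g}}_i(\mathbf{x}_k)-\mathbf{g}_i(\mathbf{x}_k)\|^2\big]}{\|\mathbf{g}_i(\mathbf{x}_k)\|^2}=\frac{d-1}{m}.$$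
   Context: Rademacher entries take the values $+1$ and $-1$ with probability $1/2$ each. $\mathbb{E}_{\mathbf{U}}$ denotes expectation over the random directions $\mathbf{U}=[\mathbf{u}^{(1)}_{k,i}\ \cdots\ \mathbf{u}^{(m)}_{k,i}]$ only, which are independent of $\mathbf{g}_i(\mathbf{x}_k)$; the vector $\mathbf{g}_i(\mathbf{x}_k)$ is treated as fixed. $\|\cdot\|$ is the Euclidean norm. *)

theory Defs
  imports "HOL-Probability.Probability"
begin

text \<open>The two probabilities add up to 1, so a Rademacher variable is in \<open>{-1, 1}\<close> almost surely.\<close>

definition rademacher :: "'a measure \<Rightarrow> ('a \<Rightarrow> real) \<Rightarrow> bool" where
  "rademacher M X \<longleftrightarrow> X \<in> borel_measurable M \<and>
     \<P>(\<omega> in M. X \<omega> = 1) = 1 / 2 \<and> \<P>(\<omega> in M. X \<omega> = - 1) = 1 / 2"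

definition rademacher_vector :: "'a measure \<Rightarrow> ('a \<Rightarrow> real ^ 'n) \<Rightarrow> bool" where
  "rademacher_vector M u \<longleftrightarrow>
     prob_space.indep_vars M (\<lambda>_. borel) (\<lambda>l \<omega>. u \<omega> $ l) UNIV \<and>
     (\<forall>l. rademacher M (\<lambda>\<omega>. u \<omega> $ l))"

text \<open>The type annotations make \<open>u\<close> an \<open>n \<times> 1\<close> and its transpose a \<open>1 \<times> n\<close> matrix.\<close>

definition outer_square :: "real ^ 'n \<Rightarrow> real ^ 'n ^ 'n" where
  "outer_square u = (columnvector u :: real ^ 1 ^ 'n) ** (rowvector u :: real ^ 'n ^ 1)"

definition grad_estimator :: "nat \<Rightarrow> (nat \<Rightarrow> real ^ 'n) \<Rightarrow> real ^ 'n \<Rightarrow> real ^ 'n" where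
  "grad_estimator m u g = (1 / real m) *\<^sub>R (\<Sum>j = 1..m. outer_square (u j) *v g)"

end

theory Submission
  imports Defs
begin

text \<open>The errors \<open>D j = u j (u j \<bullet> g) - g\<close> are independent and centred, so the cross terms in the
  expansion of \<open>\<parallel>\<Sum>j. D j\<parallel>\<^sup>2\<close> vanish in expectation. Almost surely \<open>\<parallel>u\<parallel>\<^sup>2 = d\<close>, hence
  \<open>\<parallel>D j\<parallel>\<^sup>2 = (d - 2) (u j \<bullet> g)\<^sup>2 + \<parallel>g\<parallel>\<^sup>2\<close>, and \<open>E (u j \<bullet> g)\<^sup>2 = \<parallel>g\<parallel>\<^sup>2\<close> because distinct entries
  are uncorrelated.\<close>

lemma outer_square_mult_vector: "outer_square u *v g = (u \<bullet> g) *\<^sub>R u"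
  by (simp add: outer_square_def vec_eq_iff matrix_vector_mult_def matrix_matrix_mult_def
      columnvector_def rowvector_def inner_vec_def sum_distrib_left sum_distrib_right mult_ac)

text \<open>For \<open>m \<ge> 1\<close> the vector \<open>g\<close> is the mean of \<open>m\<close>
  copies of itself, so one copy can be charged to each direction. This turns the total error into a
  mean of single-direction errors.\<close>

lemma grad_estimator_minus:
  assumes "m \<ge> 1"
  shows "grad_estimator m u g - g = (1 / real m) *\<^sub>R (\<Sum>j = 1..m. (u j \<bullet> g) *\<^sub>R u j - g)"
  using assms
  by (simp add: grad_estimator_def outer_square_mult_vector sum_subtractf scaleR_diff_right
      sum_constant_scaleR del: sum_constant)

context prob_space
begin

text \<open>The disjoint index blocks \<open>{i}\<close> and \<open>{j}\<close> yield independent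
  restricted families; projecting each one-factor product space onto its only coordinate recovers
  \<open>X i\<close> and \<open>X j\<close>.\<close>

lemma indep_vars_imp_indep_var:
  assumes "indep_vars (\<lambda>_. N) X I" "i \<in> I" "j \<in> I" "i \<noteq> j"
  shows "indep_var N (X i) N (X j)"
proof -
  have "indep_var (PiM {i} (\<lambda>_. N)) (\<lambda>\<omega>. restrict (\<lambda>k. X k \<omega>) {i})
      (PiM {j} (\<lambda>_. N)) (\<lambda>\<omega>. restrict (\<lambda>k. X k \<omega>) {j})"
    using assms by (intro indep_var_restrict[where I = I]) auto
  from indep_var_compose[OF this measurable_component_singleton[of i] measurable_component_singleton[of j]]
  show ?thesis by (simp add: comp_def)
qed

lemma AE_rademacher:
  assumes "rademacher M X"
  shows "AE \<omega> in M. X \<omega> = 1 \<or> X \<omega> = - 1"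
proof -
  have [measurable]: "X \<in> borel_measurable M"
    and p: "prob {\<omega> \<in> space M. X \<omega> = 1} = 1 / 2" "prob {\<omega> \<in> space M. X \<omega> = - 1} = 1 / 2"
    using assms by (auto simp: rademacher_def)
  have "prob ({\<omega> \<in> space M. X \<omega> = 1} \<union> {\<omega> \<in> space M. X \<omega> = - 1}) = 1"
    using p by (subst finite_measure_Union) auto
  from AE_prob_1[OF this] show ?thesis by auto
qed

lemma expectation_rademacher:
  assumes "rademacher M X"
  shows "expectation X = 0"
proof -
  have [measurable]: "X \<in> borel_measurable M"
    and p: "prob {\<omega> \<in> space M. X \<omega> = 1} = 1 / 2" "prob {\<omega> \<in> space M. X \<omega> = - 1} = 1 / 2"
    using assms by (auto simp: rademacher_def)
  \<comment> \<open>Almost surely \<open>X\<close> is 1 or -1, so it agrees with the difference of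
    the indicators of these two events, each of probability 1/2.\<close>
  have "expectation X = expectation (\<lambda>\<omega>. indicator {\<omega> \<in> space M. X \<omega> = 1} \<omega>
      - indicator {\<omega> \<in> space M. X \<omega> = - 1} \<omega>)"
    using AE_rademacher[OF assms] by (intro integral_cong_AE) (auto simp: indicator_def)
  also have "\<dots> = 0"
    using p by (subst Bochner_Integration.integral_diff) (auto simp: emeasure_eq_measure)
  finally show ?thesis .
qed

lemma rademacher_vector_AE:
  assumes "rademacher_vector M u"
  shows "AE \<omega> in M. \<forall>l. u \<omega> $ l = 1 \<or> u \<omega> $ l = - 1"
  using assms by (auto simp: rademacher_vector_def AE_all_countable intro: AE_rademacher)

lemma rademacher_vector_nth_measurable:
  assumes "rademacher_vector M u"
  shows "(\<lambda>\<omega>. u \<omega> $ l) \<in> borel_measurable M"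
  using assms by (auto simp: rademacher_vector_def rademacher_def)

lemma rademacher_vector_inner_measurable:
  assumes "rademacher_vector M u"
  shows "(\<lambda>\<omega>. u \<omega> \<bullet> g) \<in> borel_measurable M"
  using rademacher_vector_nth_measurable[OF assms] by (simp add: inner_vec_def)

lemma rademacher_vector_integrable_nth:
  assumes "rademacher_vector M u"
  shows "integrable M (\<lambda>\<omega>. u \<omega> $ l)"
proof (rule integrable_const_bound[where B = 1])
  show "AE \<omega> in M. norm (u \<omega> $ l) \<le> 1"
    using rademacher_vector_AE[OF assms]
    by eventually_elim (metis abs_1 abs_minus order_refl real_norm_def)
qed (fact rademacher_vector_nth_measurable[OF assms])

lemma rademacher_vector_integrable_mult:
  assumes "rademacher_vector M u"
  shows "integrable M (\<lambda>\<omega>. u \<omega> $ p * u \<omega> $ q)"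
proof (rule integrable_const_bound[where B = 1])
  show "AE \<omega> in M. norm (u \<omega> $ p * u \<omega> $ q) \<le> 1"
    using rademacher_vector_AE[OF assms]
    by eventually_elim (metis abs_1 abs_minus abs_mult mult_1 order_refl real_norm_def)
  show "(\<lambda>\<omega>. u \<omega> $ p * u \<omega> $ q) \<in> borel_measurable M"
    using rademacher_vector_nth_measurable[OF assms] by simp
qed

text \<open>This is E[u u^T] = I, the source of every moment below. On the diagonal the entry
  squares to 1 almost surely; off the diagonal independence factors the mean into two zero
  means.\<close>

lemma rademacher_vector_covariance:
  assumes u: "rademacher_vector M u"
  shows "expectation (\<lambda>\<omega>. u \<omega> $ p * u \<omega> $ q) = (if p = q then 1 else 0)"
proof (cases "p = q")
  case True
  have "expectation (\<lambda>\<omega>. u \<omega> $ p * u \<omega> $ p) = expectation (\<lambda>_. 1)"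
  proof (rule integral_cong_AE)
    show "AE \<omega> in M. u \<omega> $ p * u \<omega> $ p = 1"
      using rademacher_vector_AE[OF u] by eventually_elim (metis mult_1 mult_minus_left minus_minus)
  qed (use rademacher_vector_nth_measurable[OF u] in simp_all)
  with True show ?thesis by (simp add: prob_space)
next
  case False
  with u have "indep_var borel (\<lambda>\<omega>. u \<omega> $ p) borel (\<lambda>\<omega>. u \<omega> $ q)"
    by (intro indep_vars_imp_indep_var[where X = "\<lambda>l \<omega>. u \<omega> $ l"]) (auto simp: rademacher_vector_def)
  then have "expectation (\<lambda>\<omega>. u \<omega> $ p * u \<omega> $ q)
      = expectation (\<lambda>\<omega>. u \<omega> $ p) * expectation (\<lambda>\<omega>. u \<omega> $ q)"
    by (intro indep_var_lebesgue_integral rademacher_vector_integrable_nth[OF u])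
  also have "\<dots> = 0"
    using u by (simp add: rademacher_vector_def expectation_rademacher)
  finally show ?thesis using False by simp
qed

lemma rademacher_vector_integrable_error_nth:
  fixes u :: "'a \<Rightarrow> real ^ 'n"
  assumes "rademacher_vector M u"
  shows "integrable M (\<lambda>\<omega>. ((u \<omega> \<bullet> g) *\<^sub>R u \<omega> - g) $ l)"
  using rademacher_vector_integrable_mult[OF assms]
  by (simp add: inner_vec_def sum_distrib_left sum_distrib_right mult_ac)

text \<open>Expanding the inner product gives row \<open>l\<close> of E[u u^T] applied to
  \<open>g\<close>. As that matrix is the identity, the estimate from a single direction is
  unbiased.\<close>

lemma rademacher_vector_expectation_error_nth:
  fixes u :: "'a \<Rightarrow> real ^ 'n"
  assumes u: "rademacher_vector M u"
  shows "expectation (\<lambda>\<omega>. ((u \<omega> \<bullet> g) *\<^sub>R u \<omega> - g) $ l) = 0"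
proof -
  have "expectation (\<lambda>\<omega>. ((u \<omega> \<bullet> g) *\<^sub>R u \<omega> - g) $ l)
      = expectation (\<lambda>\<omega>. (\<Sum>p\<in>UNIV. g $ p * (u \<omega> $ p * u \<omega> $ l)) - g $ l)"
    by (simp add: inner_vec_def sum_distrib_left sum_distrib_right mult_ac)
  also have "\<dots> = (\<Sum>p\<in>UNIV. g $ p * (if p = l then 1 else 0)) - g $ l"
    by (simp add: rademacher_vector_integrable_mult[OF u] rademacher_vector_covariance[OF u]
        prob_space)
  finally show ?thesis by (simp add: if_distrib cong: if_cong)
qed

text \<open>The square is the quadratic form g^T (u u^T) g; taking means replaces u u^T by the
  identity.\<close>

lemma rademacher_vector_inner_power2:
  fixes u :: "'a \<Rightarrow> real ^ 'n"
  assumes u: "rademacher_vector M u"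
  shows "integrable M (\<lambda>\<omega>. (u \<omega> \<bullet> g)\<^sup>2)" (is ?int)
    and "expectation (\<lambda>\<omega>. (u \<omega> \<bullet> g)\<^sup>2) = (norm g)\<^sup>2" (is ?exp)
proof -
  have eq: "(u \<omega> \<bullet> g)\<^sup>2 = (\<Sum>p\<in>UNIV. \<Sum>q\<in>UNIV. (g $ p * g $ q) * (u \<omega> $ p * u \<omega> $ q))" for \<omega>
    by (simp add: inner_vec_def power2_eq_square sum_product mult_ac)
  show ?int
    unfolding eq by (simp add: rademacher_vector_integrable_mult[OF u])
  have "expectation (\<lambda>\<omega>. (u \<omega> \<bullet> g)\<^sup>2)
      = (\<Sum>p\<in>UNIV. \<Sum>q\<in>UNIV. (g $ p * g $ q) * (if p = q then 1 else 0))"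
    unfolding eq by (simp add: rademacher_vector_integrable_mult[OF u]
        rademacher_vector_covariance[OF u])
  also have "\<dots> = (norm g)\<^sup>2"
    by (simp add: power2_norm_eq_inner inner_vec_def if_distrib cong: if_cong)
  finally show ?exp .
qed

lemma rademacher_vector_error_norm_power2:
  fixes u :: "'a \<Rightarrow> real ^ 'n" and g :: "real ^ 'n"
  assumes u: "rademacher_vector M u"
  defines "D \<equiv> \<lambda>\<omega>. (u \<omega> \<bullet> g) *\<^sub>R u \<omega> - g"
  shows "integrable M (\<lambda>\<omega>. D \<omega> \<bullet> D \<omega>)" (is ?int)
    and "expectation (\<lambda>\<omega>. D \<omega> \<bullet> D \<omega>) = (real CARD('n) - 1) * (norm g)\<^sup>2" (is ?exp)
proof -
  \<comment> \<open>The coefficient is d from \<open>u \<omega> \<bullet> u \<omega>\<close> minus 2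
    from the two mixed terms with \<open>g\<close>. Its mean is (d - 2) + 1 = d - 1 times the
    squared norm of \<open>g\<close>.\<close>
  let ?h = "\<lambda>\<omega>. (real CARD('n) - 2) * (u \<omega> \<bullet> g)\<^sup>2 + (norm g)\<^sup>2"
  \<comment> \<open>The identity with \<open>?h\<close> holds only almost surely, so measurability
    has to be shown separately before integrability and expectation can be carried over.\<close>
  have [measurable]: "(\<lambda>\<omega>. D \<omega> \<bullet> D \<omega>) \<in> borel_measurable M"
    using rademacher_vector_nth_measurable[OF u] rademacher_vector_inner_measurable[OF u]
    by (simp add: D_def inner_vec_def)
  have h: "integrable M ?h"
    by (simp add: rademacher_vector_inner_power2[OF u])
  have ae: "AE \<omega> in M. D \<omega> \<bullet> D \<omega> = ?h \<omega>"
    using rademacher_vector_AE[OF u]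
  proof eventually_elim
    case (elim \<omega>)
    have "u \<omega> $ l * u \<omega> $ l = 1" for l
      using spec[OF elim, of l] by auto
    then have uu: "u \<omega> \<bullet> u \<omega> = real CARD('n)"
      by (simp add: inner_vec_def)
    have "D \<omega> \<bullet> D \<omega> = (u \<omega> \<bullet> g)\<^sup>2 * (u \<omega> \<bullet> u \<omega>) - 2 * (u \<omega> \<bullet> g)\<^sup>2 + g \<bullet> g"
      by (simp add: D_def inner_diff_left inner_diff_right inner_commute power2_eq_square)
    then show ?case
      by (simp add: uu power2_norm_eq_inner algebra_simps)
  qed
  have "integrable M (\<lambda>\<omega>. D \<omega> \<bullet> D \<omega>) \<longleftrightarrow> integrable M ?h"
    using ae h by (intro integrable_cong_AE) auto
  with h show ?int by blast
  have "expectation (\<lambda>\<omega>. D \<omega> \<bullet> D \<omega>) = expectation ?h"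
    using ae h by (intro integral_cong_AE) auto
  also have "\<dots> = (real CARD('n) - 1) * (norm g)\<^sup>2"
    by (simp add: rademacher_vector_inner_power2[OF u] prob_space algebra_simps)
  finally show ?exp .
qed

text \<open>The inner product is a sum over coordinates, so it suffices to treat the same coordinate
  of both errors: these are independent, integrable and centred real variables, whose product is
  integrable with mean zero.\<close>

lemma rademacher_vector_indep_error_inner:
  fixes u v :: "'a \<Rightarrow> real ^ 'n" and g :: "real ^ 'n"
  assumes u: "rademacher_vector M u" and v: "rademacher_vector M v"
    and uv: "indep_var borel u borel v"
  defines "D \<equiv> \<lambda>w \<omega>. (w \<omega> \<bullet> g) *\<^sub>R w \<omega> - g"
  shows "integrable M (\<lambda>\<omega>. D u \<omega> \<bullet> D v \<omega>)" (is ?int)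
    and "expectation (\<lambda>\<omega>. D u \<omega> \<bullet> D v \<omega>) = 0" (is ?exp)
proof -
  have ind: "indep_var borel (\<lambda>\<omega>. D u \<omega> $ l) borel (\<lambda>\<omega>. D v \<omega> $ l)" for l
  proof -
    let ?f = "\<lambda>x :: real ^ 'n. ((x \<bullet> g) *\<^sub>R x - g) $ l"
    \<comment> \<open>Each coordinate of the error is a quadratic polynomial in the direction, hence
      continuous and Borel, so it inherits independence from \<open>u\<close> and
      \<open>v\<close>.\<close>
    have "?f \<in> borel_measurable borel"
      by (intro borel_measurable_continuous_onI continuous_intros)
    from indep_var_compose[OF uv this this] show ?thesis
      by (simp add: comp_def D_def)
  qed
  have int: "integrable M (\<lambda>\<omega>. D u \<omega> $ l)" "integrable M (\<lambda>\<omega>. D v \<omega> $ l)" for l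
    unfolding D_def by (intro rademacher_vector_integrable_error_nth u v)+
  have prod: "integrable M (\<lambda>\<omega>. D u \<omega> $ l * D v \<omega> $ l)" for l
    by (intro indep_var_integrable ind int)
  then show ?int
    by (simp add: inner_vec_def)
  have "expectation (\<lambda>\<omega>. D u \<omega> $ l * D v \<omega> $ l) = 0" for l
    using indep_var_lebesgue_integral[OF ind int, of l]
      rademacher_vector_expectation_error_nth[OF u, of g l] by (simp only: D_def mult_zero_left)
  then show ?exp
    by (simp add: inner_vec_def prod)
qed

end

theorem lemma3:
  fixes M :: "'a measure" and U :: "nat \<Rightarrow> 'a \<Rightarrow> real ^ 'n" and g :: "real ^ 'n" and m :: nat
  assumes "prob_space M"
    and "m \<ge> 1"
    and "g \<noteq> 0"
    and "prob_space.indep_vars M (\<lambda>_. borel) U {1..m}"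
    and "\<And>j. j \<in> {1..m} \<Longrightarrow> rademacher_vector M (U j)"
  shows "prob_space.expectation M (\<lambda>\<omega>. (norm (grad_estimator m (\<lambda>j. U j \<omega>) g - g))\<^sup>2) / (norm g)\<^sup>2
    = (real CARD('n) - 1) / real m"
proof -
  interpret prob_space M by fact
  define D where "D = (\<lambda>j \<omega>. (U j \<omega> \<bullet> g) *\<^sub>R U j \<omega> - g)"
  let ?c = "(real CARD('n) - 1) * (norm g)\<^sup>2"
  \<comment> \<open>The matrix of mean inner products of the errors is diagonal, with
    \<open>?c\<close> on the diagonal. Integrability is recorded alongside because exchanging
    expectation and the double sum relies on it.\<close>
  have cross: "integrable M (\<lambda>\<omega>. D j \<omega> \<bullet> D k \<omega>) \<and>
      expectation (\<lambda>\<omega>. D j \<omega> \<bullet> D k \<omega>) = (if j = k then ?c else 0)"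
    if "j \<in> {1..m}" "k \<in> {1..m}" for j k
  proof (cases "j = k")
    case True
    then show ?thesis
      using rademacher_vector_error_norm_power2[OF assms(5)[OF that(1)], of g]
      by (simp add: D_def)
  next
    case False
    then have "indep_var borel (U j) borel (U k)"
      using assms(4) that by (intro indep_vars_imp_indep_var)
    from rademacher_vector_indep_error_inner[OF assms(5) assms(5) this, OF that, of g] False
    show ?thesis by (simp add: D_def)
  qed
  have "(norm (grad_estimator m (\<lambda>j. U j \<omega>) g - g))\<^sup>2
      = (1 / (real m)\<^sup>2) * (\<Sum>j = 1..m. \<Sum>k = 1..m. D j \<omega> \<bullet> D k \<omega>)" for \<omega>
    unfolding grad_estimator_minus[OF assms(2)] D_def[symmetric] power2_norm_eq_inner
    by (simp add: D_def inner_sum_left inner_sum_right power2_eq_square inner_commute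
        sum_divide_distrib)
  then have "expectation (\<lambda>\<omega>. (norm (grad_estimator m (\<lambda>j. U j \<omega>) g - g))\<^sup>2)
      = (1 / (real m)\<^sup>2) * expectation (\<lambda>\<omega>. \<Sum>j = 1..m. \<Sum>k = 1..m. D j \<omega> \<bullet> D k \<omega>)"
    by simp
  also have "expectation (\<lambda>\<omega>. \<Sum>j = 1..m. \<Sum>k = 1..m. D j \<omega> \<bullet> D k \<omega>)
      = (\<Sum>j = 1..m. \<Sum>k = 1..m. expectation (\<lambda>\<omega>. D j \<omega> \<bullet> D k \<omega>))"
    using cross by (subst Bochner_Integration.integral_sum;
        (intro Bochner_Integration.integrable_sum sum.cong Bochner_Integration.integral_sum)?) auto
  also have "\<dots> = (\<Sum>j = 1..m. \<Sum>k = 1..m. if j = k then ?c else 0)"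
    using cross by (intro sum.cong) auto
  \<comment> \<open>Only the \<open>m\<close> diagonal terms survive; against the prefactor 1/m^2
    they leave 1/m, and \<open>g \<noteq> 0\<close> lets the squared norm cancel.\<close>
  also have "\<dots> = real m * ?c"
    by simp
  finally show ?thesis
    using assms(2,3) by (simp add: power2_eq_square)
qed

end
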